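(* Let $n\ge2$. The leading term of the asymptotics as $p\to0$ of the $q$-hypergeometric solutions $(\Psi_J(p,\boldsymbol y,\boldsymbol z))_{J=1}^n$ is the product of the equivariant gamma class of the tangent bundle of $P^{n-1}$ and the exponential of the equivariant first Chern class of the tautological line bundle $\mathcal L$: $$\mathcal E=\bigl(e^{\pi\sqrt{-1}(2-n)}p\bigr)^{c_1(\mathcal L)}\,\hat\Gamma_{P^{n-1}},\qquad \hat\Gamma_{P^{n-1}}=\prod_{a=1}^{n-1}\Gamma(1+y_a-x),\quad c_1(\mathcal L)=x.$$ That is, for every $\boldsymbol z\in L''$ and every $J=1,\dots,n$, as $p\to0$, $$\Psi_J(p,\boldsymbol y,\boldsymbol z)=\mathcal E|_{pt_J}\,\bigl(\Delta_J+O(p)\bigr),\qquad \mathcal E|_{pt_J}=(e^{\pi\sqrt{-1}(2-n)}p)^{z_J}\prod_{a\ne J}\Gamma(1+z_a-z_J),$$ where $\Delta_J$ is the class that restricts to $1$ at $pt_J$ and to $0$ at all $pt_I$, $I\neq J$.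
   Context: $T^n=(\mathbb C^\times)^n$ acts diagonally on $P^{n-1}$ (lines $F\subset\mathbb C^n$), with fixed points $pt_1,\dots,pt_n$ the coordinate lines. With $x$ the equivariant Chern root of the tautological line bundle $\mathcal L$ (fiber $F$), $\boldsymbol y=(y_1,\dots,y_{n-1})$ the equivariant Chern roots of the bundle with fiber $\mathbb C^n/F$, and $\boldsymbol z=(z_1,\dots,z_n)$ the equivariant parameters, $$H_{T^n}(P^{n-1};\mathbb C)=\mathbb C[x,\boldsymbol z]\Big/\Bigl\langle\prod_{a=1}^n(x-z_a)\Bigr\rangle=\mathbb C[x,\boldsymbol y,\boldsymbol z]^{S_{n-1}}\Big/\Bigl\langle (u-x)\prod_{j=1}^{n-1}(u-y_j)-\prod_{a=1}^n(u-z_a)\Bigr\rangle$$ (relation imposed identically in $u$). Restriction to $pt_I$ sends $x\mapsto z_I$ and $\{y_1,\dots,y_{n-1}\}\mapsto\{z_a:a\ne I\}$. For $\boldsymbol z$ with distinct coordinates the restrictions to the fixed points identify the fiber of $H_{T^n}(P^{n-1};\mathbb C)$ at $\boldsymbol z$ with $\mathbb C^n$; analytic functions of $x,\boldsymbol y$ (symmetric in $\boldsymbol y$) are understood through these restrictions. Let $L'$ be the $p$-plane $\mathbb C$ with a ray from $0$ to $\infty$ deleted and $\arg p$ fixed, and let $L''\subset\mathbb C^n$ be the set of $\boldsymbol z$ with $z_a-z_b\notin\mathbb Z$ for all $a\ne b$. Define, for $p\in L'$, $\boldsymbol z\in L''$, $$\Phi(t,p,\boldsymbol z)=(e^{\pi\sqrt{-1}(2-n)}p)^t\prod_{a=1}^n\Gamma(z_a-t),\qquad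 W(t,\boldsymbol y)=\prod_{j=1}^{n-1}(y_j-t),$$ $$\Psi_J(p,\boldsymbol y,\boldsymbol z)=-\sum_{r\in\mathbb Z_{\ge0}}\operatorname{Res}_{t=z_J+r}\Phi(t,p,\boldsymbol z)W(t,\boldsymbol y),\qquad J=1,\dots,n.$$ These are called the $q$-hypergeometric solutions; they are solutions of the equivariant quantum differential equation of $P^{n-1}$. *)

theory Defs
  imports "HOL-Complex_Analysis.Complex_Analysis" "HOL-Library.Multiset" "HOL-Library.Landau_Symbols"
begin

text \<open>
  Notation: the index type \<open>'n\<close> labels the torus-fixed points, so \<open>n = CARD('n)\<close>.
  The variable \<open>x\<close> is the Chern root of the tautological line bundle; a function that is
  symmetric in the Chern roots \<open>y\<^sub>1, \<dots>, y\<^sub>n\<^sub>-\<^sub>1\<close> of the quotient bundle is a function of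
  the multiset \<open>Y\<close> of these roots.
\<close>

section \<open>The domains of the variables\<close>

definition slit_plane :: "real \<Rightarrow> complex set" where
  "slit_plane \<theta> = - {complex_of_real s * cis \<theta> | s. s \<ge> 0}"

text \<open>A choice of the argument on a slit plane; it is unique up to a multiple of \<open>2 * pi\<close>.\<close>

definition arg_branch :: "complex set \<Rightarrow> (complex \<Rightarrow> real) \<Rightarrow> bool" where
  "arg_branch L \<alpha> \<longleftrightarrow>
     continuous_on L \<alpha> \<and> (\<forall>p\<in>L. p = complex_of_real (cmod p) * cis (\<alpha> p))"

definition nonresonant :: "(complex ^ 'n) set" where
  "nonresonant = {z. \<forall>a b. a \<noteq> b \<longrightarrow> z $ a - z $ b \<notin> \<int>}"

section \<open>Restriction to the fixed points\<close>

definition other_weights :: "complex ^ 'n \<Rightarrow> 'n \<Rightarrow> complex multiset" where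
  "other_weights z I = image_mset (\<lambda>a. z $ a) (mset_set (UNIV - {I}))"

text \<open>
  The fibre at \<open>z\<close> of the equivariant cohomology is identified with the space
  \<open>complex ^ 'n\<close> by restriction to the fixed points. The element given by a function \<open>f\<close> of
  \<open>x\<close> and \<open>Y\<close> has as its \<open>I\<close>-th component the restriction of \<open>f\<close> to the \<open>I\<close>-th fixed
  point, and \<open>fixed_point_relation\<close> is the defining relation of the cohomology ring
  at that point.
\<close>

definition class_at :: "complex ^ 'n \<Rightarrow> (complex \<Rightarrow> complex multiset \<Rightarrow> complex) \<Rightarrow> complex ^ 'n" where
  "class_at z f = (\<chi> I. f (z $ I) (other_weights z I))"

lemma fixed_point_relation:
  fixes z :: "complex ^ 'n"
  shows "(u - z $ I) * (\<Prod>y\<in>#other_weights z I. u - y) = (\<Prod>a\<in>UNIV. u - z $ a)"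
  by (simp add: other_weights_def image_mset.compositionality comp_def
      prod_unfold_prod_mset [symmetric] prod.remove [of UNIV I])

definition Delta :: "'n \<Rightarrow> complex ^ 'n" where
  "Delta J = (\<chi> I. if I = J then 1 else 0)"

section \<open>Characteristic classes in terms of Chern roots\<close>

definition c1 :: "complex multiset \<Rightarrow> complex" where
  "c1 V = (\<Sum>w\<in>#V. w)"

definition gamma_class :: "complex multiset \<Rightarrow> complex" where
  "gamma_class V = (\<Prod>w\<in>#V. Gamma (1 + w))"

definition taut_roots :: "complex \<Rightarrow> complex multiset" where
  "taut_roots x = {#x#}"

text \<open>The tangent bundle at a line \<open>F\<close> is \<open>Hom(F, C^n/F)\<close>.\<close>

definition tangent_roots :: "complex \<Rightarrow> complex multiset \<Rightarrow> complex multiset" where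
  "tangent_roots x Y = image_mset (\<lambda>y. y - x) Y"

section \<open>The q-hypergeometric solutions and their leading term\<close>

text \<open>
  \<open>twisted_power \<alpha> n p t\<close> is \<open>(e^(pi i (2 - n)) p)^t\<close>, where the argument of the base is
  taken to be \<open>pi (2 - n) + \<alpha> p\<close>, not its principal value.
\<close>

definition twisted_power :: "(complex \<Rightarrow> real) \<Rightarrow> nat \<Rightarrow> complex \<Rightarrow> complex \<Rightarrow> complex" where
  "twisted_power \<alpha> n p t =
     exp (t * (complex_of_real (ln (cmod p)) + \<i> * complex_of_real (pi * (2 - real n) + \<alpha> p)))"

definition Phi :: "(complex \<Rightarrow> real) \<Rightarrow> complex \<Rightarrow> complex \<Rightarrow> complex ^ 'n \<Rightarrow> complex" where
  "Phi \<alpha> t p z = twisted_power \<alpha> CARD('n) p t * (\<Prod>a\<in>UNIV. Gamma (z $ a - t))"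

definition W :: "complex \<Rightarrow> complex multiset \<Rightarrow> complex" where
  "W t Y = (\<Prod>y\<in>#Y. y - t)"

definition Psi ::
  "(complex \<Rightarrow> real) \<Rightarrow> 'n \<Rightarrow> complex \<Rightarrow> complex multiset \<Rightarrow> complex ^ 'n \<Rightarrow> complex" where
  "Psi \<alpha> J p Y z = - (\<Sum>r. residue (\<lambda>t. Phi \<alpha> t p z * W t Y) (z $ J + of_nat r))"

definition leading_class ::
  "(complex \<Rightarrow> real) \<Rightarrow> nat \<Rightarrow> complex \<Rightarrow> complex \<Rightarrow> complex multiset \<Rightarrow> complex" where
  "leading_class \<alpha> n p x Y =
     twisted_power \<alpha> n p (c1 (taut_roots x)) * gamma_class (tangent_roots x Y)"

end

theory Submission
  imports Defs
begin

text \<open>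
  At \<open>t = z\<^sub>J + r\<close> only the factor \<open>\<Gamma>(z\<^sub>J - t)\<close> of \<open>\<Phi>\<close> has a pole, and that pole is simple,
  because the differences \<open>z\<^sub>a - z\<^sub>J\<close> are not integers. Hence every residue is explicit
  (\<open>residue_Phi_W\<close>). Since \<open>(e\<^bsup>\<pi>i(2-n)\<^esup> p)\<^bsup>t+r\<^esup> = (e\<^bsup>\<pi>i(2-n)\<^esup> p)\<^bsup>t\<^esup> ((-1)\<^sup>n p)\<^sup>r\<close> whatever
  the branch of the argument (\<open>twisted_power_add_nat\<close>), the multivalued part of the \<open>r\<close>-th
  residue does not depend on \<open>r\<close>. So the restriction of \<open>\<Psi>\<^sub>J\<close> to \<open>pt\<^sub>I\<close> is
  \<open>(e\<^bsup>\<pi>i(2-n)\<^esup> p)\<close> to the power \<open>z\<^sub>J\<close>, times the power series in \<open>p\<close> with coefficients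
  \<open>solution_coeff z J I r\<close>.

  The factor \<open>1 / r!\<close> outweighs the other factors of the coefficient, which grow at most
  geometrically, so this series is entire (\<open>solution_coeff_summable\<close>), and it differs from its
  constant term by \<open>O(p)\<close>. The constant term contains the product of the \<open>z\<^sub>b - z\<^sub>J\<close> over
  \<open>b \<noteq> I\<close>. If \<open>I \<noteq> J\<close>, the index \<open>b = J\<close> makes it vanish; if \<open>I = J\<close>, each
  \<open>z\<^sub>a - z\<^sub>J\<close> raises the argument of \<open>\<Gamma>(z\<^sub>a - z\<^sub>J)\<close> by one, which gives the gamma class at
  \<open>pt\<^sub>J\<close> (\<open>solution_coeff_0\<close>). That number is not zero, and dividing by it gives the
  factor \<open>\<Delta>\<^sub>J + O(p)\<close>.
\<close>

section \<open>Residues of the master function\<close>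

text \<open>
  The residue of \<open>\<Gamma>\<close> at \<open>-r\<close> is \<open>(-1)\<^sup>r / r!\<close>; the extra sign comes from the substitution
  \<open>s = c - t\<close>. The pole is simple, so only the value of \<open>g\<close> enters and none of its derivatives.
\<close>

lemma residue_Gamma_reflected_mult:
  fixes g :: "complex \<Rightarrow> complex"
  assumes S: "open S" "c + of_nat r \<in> S" and g: "g holomorphic_on S"
  shows "residue (\<lambda>t. Gamma (c - t) * g t) (c + of_nat r)
           = - ((-1) ^ r / fact r) * g (c + of_nat r)"
proof -
  let ?t = "c + of_nat r :: complex"
  \<comment> \<open>Removing the other poles of \<open>\<Gamma>(c - t)\<close> leaves an open set with a single singularity.\<close>
  define D where "D = S - (\<lambda>t. c - t) -` (\<int>\<^sub>\<le>\<^sub>0 - {- of_nat r})"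
  have "closed (\<int>\<^sub>\<le>\<^sub>0 - {- of_nat r} :: complex set)"
    by (intro closed_subset_Ints) (auto elim: nonpos_Ints_cases)
  then have "closed ((\<lambda>t. c - t) -` (\<int>\<^sub>\<le>\<^sub>0 - {- of_nat r}))"
    by (rule closed_vimage) (intro continuous_intros)
  then have D: "open D"
    unfolding D_def using S(1) by (intro open_Diff)
  have tD: "?t \<in> D"
    using S(2) by (simp add: D_def)
  have "(\<lambda>t. Gamma (c - t)) holomorphic_on D - {?t}"
  proof (intro holomorphic_intros)
    fix t assume "t \<in> D - {?t}"
    then have "c - t \<notin> \<int>\<^sub>\<le>\<^sub>0 - {- of_nat r}" "c - t \<noteq> - of_nat r"
      by (auto simp: D_def algebra_simps)
    then show "c - t \<notin> \<int>\<^sub>\<le>\<^sub>0" by blast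
  qed
  moreover have "g holomorphic_on D - {?t}"
    using g by (rule holomorphic_on_subset) (auto simp: D_def)
  ultimately have hol: "(\<lambda>t. Gamma (c - t) * g t) holomorphic_on D - {?t}"
    by (rule holomorphic_on_mult)
  have "filterlim (\<lambda>t. c - t) (at (- of_nat r)) (at ?t)"
  proof (intro filterlim_atI)
    show "((\<lambda>t. c - t) \<longlongrightarrow> - of_nat r) (at ?t)"
      by (auto intro!: tendsto_eq_intros)
    show "\<forall>\<^sub>F t in at ?t. c - t \<noteq> - of_nat r"
      by (auto simp: eventually_at_filter algebra_simps)
  qed
  from filterlim_compose[OF Gamma_residues this]
  have "((\<lambda>t. Gamma (c - t) * (c - t + of_nat r)) \<longlongrightarrow> (-1) ^ r / fact r) (at ?t)" .
  moreover have "(g \<longlongrightarrow> g ?t) (at ?t)"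
    using g S by (metis continuous_within holomorphic_on_imp_continuous_on continuous_on_eq_continuous_at)
  ultimately have "((\<lambda>t. - (Gamma (c - t) * (c - t + of_nat r)) * g t) \<longlongrightarrow>
      - ((-1) ^ r / fact r) * g ?t) (at ?t)"
    by (intro tendsto_intros)
  then have "((\<lambda>t. Gamma (c - t) * g t * (t - ?t)) \<longlongrightarrow> - ((-1) ^ r / fact r) * g ?t) (at ?t)"
    by (simp add: algebra_simps)
  with D tD hol show ?thesis
    by (intro residue_simple')
qed

lemma twisted_power_holomorphic: "(\<lambda>t. twisted_power \<alpha> n p t) holomorphic_on S"
  unfolding twisted_power_def by (intro holomorphic_intros)

lemma W_other_weights: "W t (other_weights z I) = (\<Prod>b\<in>UNIV - {I}. z $ b - t)"
  by (simp add: W_def other_weights_def image_mset.compositionality comp_def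
      prod_unfold_prod_mset)

text \<open>
  All factors of \<open>\<Phi>\<close> other than \<open>\<Gamma>(z\<^sub>J - t)\<close> are holomorphic near \<open>z\<^sub>J + r\<close>: a pole there
  would make some \<open>z\<^sub>a - z\<^sub>J\<close> an integer.
\<close>

lemma residue_Phi_W:
  fixes z :: "complex ^ 'n"
  assumes z: "z \<in> nonresonant"
  shows "residue (\<lambda>t. Phi \<alpha> t p z * W t (other_weights z I)) (z $ J + of_nat r) =
           - ((-1) ^ r / fact r) * (twisted_power \<alpha> CARD('n) p (z $ J + of_nat r) *
             (\<Prod>a\<in>UNIV - {J}. Gamma (z $ a - z $ J - of_nat r)) *
             (\<Prod>b\<in>UNIV - {I}. z $ b - z $ J - of_nat r))"
proof -
  define g where "g t = twisted_power \<alpha> CARD('n) p t * (\<Prod>a\<in>UNIV - {J}. Gamma (z $ a - t)) *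
     (\<Prod>b\<in>UNIV - {I}. z $ b - t)" for t
  define S where "S = (\<Inter>a\<in>UNIV - {J}. - ((\<lambda>t. z $ a - t) -` \<int>\<^sub>\<le>\<^sub>0))"
  have "open S"
    unfolding S_def
    by (intro open_INT ballI open_Compl closed_vimage continuous_intros) auto
  moreover have "z $ J + of_nat r \<in> S"
  proof -
    have "z $ a - (z $ J + of_nat r) \<notin> \<int>\<^sub>\<le>\<^sub>0" if "a \<noteq> J" for a
    proof
      assume "z $ a - (z $ J + of_nat r) \<in> \<int>\<^sub>\<le>\<^sub>0"
      then have "z $ a - (z $ J + of_nat r) + of_nat r \<in> \<int>"
        by (intro Ints_add) (auto elim: nonpos_Ints_cases)
      with z that show False by (simp add: nonresonant_def)
    qed
    then show ?thesis by (auto simp: S_def)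
  qed
  moreover have "g holomorphic_on S"
    unfolding g_def
    by (intro holomorphic_intros twisted_power_holomorphic) (auto simp: S_def)
  ultimately have "residue (\<lambda>t. Gamma (z $ J - t) * g t) (z $ J + of_nat r)
      = - ((-1) ^ r / fact r) * g (z $ J + of_nat r)"
    by (rule residue_Gamma_reflected_mult)
  moreover have "Phi \<alpha> t p z * W t (other_weights z I) = Gamma (z $ J - t) * g t" for t
    by (simp add: Phi_def g_def W_other_weights prod.remove[of UNIV J] mult_ac)
  ultimately show ?thesis
    by (simp add: g_def diff_diff_eq)
qed

section \<open>The solutions as power series\<close>

text \<open>
  The exponential of the chosen logarithm of the base is the base itself, with
  \<open>e\<^bsup>\<pi>i(2-n)\<^esup> = (-1)\<^sup>n\<close>, so for integer shifts of the exponent the branch is irrelevant.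
\<close>

lemma twisted_power_add_nat:
  assumes "arg_branch L \<alpha>" "p \<in> L" "p \<noteq> 0"
  shows "twisted_power \<alpha> n p (t + of_nat r) = twisted_power \<alpha> n p t * ((-1) ^ n * p) ^ r"
proof -
  let ?l = "complex_of_real (ln (cmod p)) + \<i> * complex_of_real (pi * (2 - real n) + \<alpha> p)"
  have "exp ?l = exp (of_real (ln (cmod p))) * cis (pi * (2 - real n) + \<alpha> p)"
    by (simp add: exp_add cis_conv_exp)
  also have "exp (complex_of_real (ln (cmod p))) = of_real (cmod p)"
    using assms(3) by (simp add: exp_of_real)
  also have "cis (pi * (2 - real n) + \<alpha> p) = cis (2 * pi) * cis (- (real n * pi)) * cis (\<alpha> p)"
    by (simp add: cis_mult algebra_simps)
  also have "cis (- (real n * pi)) = (-1) ^ n"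
    using DeMoivre[of "-pi" n] by (simp add: complex_eq_iff cis.ctr)
  also have "of_real (cmod p) * (cis (2 * pi) * (-1) ^ n * cis (\<alpha> p))
      = (-1) ^ n * (of_real (cmod p) * cis (\<alpha> p))"
    by simp
  also have "of_real (cmod p) * cis (\<alpha> p) = p"
    using assms(1,2) by (auto simp: arg_branch_def)
  finally have "exp ?l = (-1) ^ n * p" .
  then show ?thesis
    by (simp add: twisted_power_def ring_distribs(2) exp_add exp_of_nat_mult)
qed

text \<open>
  The factors are, in order, the residue of \<open>\<Gamma>(z\<^sub>J - t)\<close> with reversed sign together with the sign
  carried by \<open>p\<^sup>r\<close>, the regular gamma factors of \<open>\<Phi>\<close> at \<open>t = z\<^sub>J + r\<close>, and the restriction
  of \<open>W\<close> to \<open>pt\<^sub>I\<close>.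
\<close>

definition solution_coeff :: "complex ^ 'n \<Rightarrow> 'n \<Rightarrow> 'n \<Rightarrow> nat \<Rightarrow> complex" where
  "solution_coeff z J I r =
     (-1) ^ r / fact r * ((-1) ^ CARD('n)) ^ r *
     (\<Prod>a\<in>UNIV - {J}. Gamma (z $ a - z $ J - of_nat r)) *
     (\<Prod>b\<in>UNIV - {I}. z $ b - z $ J - of_nat r)"

text \<open>
  Each step \<open>\<Gamma>(v) = \<Gamma>(v + 1) / v\<close> to the left divides by a number \<open>v \<in> w + \<int>\<close>, whose modulus
  is at least the distance from \<open>w\<close> to \<open>\<int>\<close>.
\<close>

lemma norm_Gamma_diff_nat_le:
  fixes w :: complex
  assumes "w \<notin> \<int>"
  shows "norm (Gamma (w - of_nat r)) \<le> norm (Gamma w) * inverse (infdist w \<int>) ^ r"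
proof (induction r)
  case 0
  show ?case by simp
next
  case (Suc r)
  let ?v = "w - of_nat (Suc r)"
  have pos: "infdist w \<int> > 0"
    using assms by (intro infdist_pos_not_in_closed) (auto intro: Ints_0)
  have le: "infdist w \<int> \<le> norm ?v"
    using infdist_le[of "of_nat (Suc r)" \<int> w] by (simp add: dist_norm)
  have "?v \<notin> \<int>"
  proof
    assume "?v \<in> \<int>"
    then have "?v + of_nat (Suc r) \<in> \<int>" by (rule Ints_add) simp
    with assms show False by simp
  qed
  then have "Gamma (?v + 1) = ?v * Gamma ?v"
    by (intro Gamma_plus1) (auto elim: nonpos_Ints_cases)
  then have "norm ?v * norm (Gamma ?v) = norm (Gamma (w - of_nat r))"
    by (simp add: norm_mult flip: norm_mult)
  with mult_right_mono[OF le norm_ge_zero[of "Gamma ?v"]]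
  have "infdist w \<int> * norm (Gamma ?v) \<le> norm (Gamma (w - of_nat r))"
    by simp
  then have "norm (Gamma ?v) \<le> norm (Gamma (w - of_nat r)) * inverse (infdist w \<int>)"
    using pos by (simp add: field_simps)
  also have "\<dots> \<le> norm (Gamma w) * inverse (infdist w \<int>) ^ r * inverse (infdist w \<int>)"
    using Suc.IH pos by (intro mult_right_mono) auto
  finally show ?case by (simp add: mult_ac)
qed

text \<open>
  A crude bound for the linear factors of \<open>W\<close>: the shape \<open>C K\<^sup>r\<close> lets the bounds of all factors
  be multiplied together.
\<close>

lemma norm_diff_nat_le_exp: "norm (w - of_nat r :: complex) \<le> exp (norm w) * exp 1 ^ r"
proof -
  have "norm (w - of_nat r) \<le> norm w + real r"
    using norm_triangle_ineq4[of w "of_nat r"] by simp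
  also have "\<dots> \<le> exp (norm w + real r)"
    using exp_ge_add_one_self[of "norm w + real r"] by linarith
  also have "\<dots> = exp (norm w) * exp 1 ^ r"
    by (simp add: exp_add flip: exp_of_nat_mult)
  finally show ?thesis .
qed

text \<open>
  The bounds on the individual factors give \<open>C K\<^sup>r / r!\<close> for the \<open>r\<close>-th coefficient, so
  the exponential series is a majorant for every \<open>q\<close>.
\<close>

lemma solution_coeff_summable:
  fixes z :: "complex ^ 'n"
  assumes z: "z \<in> nonresonant"
  shows "summable (\<lambda>r. solution_coeff z J I r * q ^ r)"
proof -
  define w where "w a = z $ a - z $ J" for a
  define C where "C = (\<Prod>a\<in>UNIV - {J}. norm (Gamma (w a))) * (\<Prod>b\<in>UNIV - {I}. exp (norm (w b)))"
  define K where "K = (\<Prod>a\<in>UNIV - {J}. inverse (infdist (w a) \<int>)) * (\<Prod>b\<in>UNIV - {I}. exp (1::real))"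
  have "norm (solution_coeff z J I r * q ^ r) \<le> C * (inverse (fact r) * (K * norm q) ^ r)" for r
  proof -
    have "(\<Prod>a\<in>UNIV - {J}. norm (Gamma (w a - of_nat r)))
        \<le> (\<Prod>a\<in>UNIV - {J}. norm (Gamma (w a)) * inverse (infdist (w a) \<int>) ^ r)"
      using z by (intro prod_mono conjI norm_Gamma_diff_nat_le) (auto simp: w_def nonresonant_def)
    moreover have "(\<Prod>b\<in>UNIV - {I}. norm (w b - of_nat r))
        \<le> (\<Prod>b\<in>UNIV - {I}. exp (norm (w b)) * exp 1 ^ r)"
      by (intro prod_mono conjI norm_diff_nat_le_exp) auto
    ultimately have "(\<Prod>a\<in>UNIV - {J}. norm (Gamma (w a - of_nat r))) *
          (\<Prod>b\<in>UNIV - {I}. norm (w b - of_nat r)) \<le>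
        (\<Prod>a\<in>UNIV - {J}. norm (Gamma (w a)) * inverse (infdist (w a) \<int>) ^ r) *
          (\<Prod>b\<in>UNIV - {I}. exp (norm (w b)) * exp 1 ^ r)"
      by (intro mult_mono prod_nonneg) (auto intro!: mult_nonneg_nonneg zero_le_power simp: infdist_nonneg)
    also have "\<dots> = C * K ^ r"
      by (simp add: C_def K_def prod.distrib prod_power_distrib power_mult_distrib mult_ac
          del: prod_constant)
    finally have "(\<Prod>a\<in>UNIV - {J}. norm (Gamma (w a - of_nat r))) *
        (\<Prod>b\<in>UNIV - {I}. norm (w b - of_nat r)) * (norm q ^ r / fact r)
        \<le> C * K ^ r * (norm q ^ r / fact r)"
      by (intro mult_right_mono) auto
    then show ?thesis
      by (simp add: solution_coeff_def w_def norm_mult norm_divide norm_power prod_norm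
          power_mult_distrib field_simps)
  qed
  then show ?thesis
    by (intro summable_comparison_test'[OF summable_mult[OF summable_exp]])
qed

lemma Psi_eq_power_series:
  fixes z :: "complex ^ 'n"
  assumes z: "z \<in> nonresonant" and p: "arg_branch L \<alpha>" "p \<in> L" "p \<noteq> 0"
  shows "Psi \<alpha> J p (other_weights z I) z =
    twisted_power \<alpha> CARD('n) p (z $ J) * (\<Sum>r. solution_coeff z J I r * p ^ r)"
proof -
  have "residue (\<lambda>t. Phi \<alpha> t p z * W t (other_weights z I)) (z $ J + of_nat r) =
      - twisted_power \<alpha> CARD('n) p (z $ J) * (solution_coeff z J I r * p ^ r)" for r
    by (simp add: residue_Phi_W[OF z] twisted_power_add_nat[OF p] solution_coeff_def
        power_mult_distrib mult_ac)
  then have "Psi \<alpha> J p (other_weights z I) z =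
      - (\<Sum>r. - twisted_power \<alpha> CARD('n) p (z $ J) * (solution_coeff z J I r * p ^ r))"
    by (simp only: Psi_def)
  then show ?thesis
    by (simp only: suminf_mult[OF solution_coeff_summable[OF z]]) simp
qed

text \<open>
  If \<open>I = J\<close>, the zeroth coefficient consists of the pairs \<open>(z\<^sub>a - z\<^sub>J) \<Gamma>(z\<^sub>a - z\<^sub>J)\<close>; if
  \<open>I \<noteq> J\<close>, the second product contains \<open>z\<^sub>J - z\<^sub>J\<close>.
\<close>

lemma solution_coeff_0:
  fixes z :: "complex ^ 'n"
  assumes z: "z \<in> nonresonant"
  shows "solution_coeff z J I 0 = (\<Prod>a\<in>UNIV - {J}. Gamma (1 + z $ a - z $ J)) * Delta J $ I"
proof (cases "I = J")
  case True
  have "Gamma (1 + z $ a - z $ J) = (z $ a - z $ J) * Gamma (z $ a - z $ J)" if "a \<noteq> J" for a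
    using z that Gamma_plus1[of "z $ a - z $ J"]
    by (auto simp: nonresonant_def algebra_simps elim: nonpos_Ints_cases)
  then show ?thesis
    by (simp add: True solution_coeff_def Delta_def prod.distrib)
next
  case False
  then have "(\<Prod>b\<in>UNIV - {I}. z $ b - z $ J) = 0"
    by auto
  with False show ?thesis
    by (simp add: solution_coeff_def Delta_def)
qed

section \<open>The leading term\<close>

text \<open>
  The difference quotient at \<open>0\<close> converges to the derivative, hence stays bounded.
\<close>

lemma power_series_remainder_bigo:
  fixes c :: "nat \<Rightarrow> complex"
  assumes "\<And>q. summable (\<lambda>r. c r * q ^ r)"
  shows "(\<lambda>q. (\<Sum>r. c r * q ^ r) - c 0) \<in> O[at 0 within S](\<lambda>q. q)"
proof -
  let ?f = "\<lambda>q. \<Sum>r. c r * q ^ r"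
  obtain D where "(?f has_field_derivative D) (at 0)"
    using termdiffs_strong_converges_everywhere[OF assms] by blast
  then have "((\<lambda>q. (?f q - ?f 0) / q) \<longlongrightarrow> D) (at 0)"
    by (simp add: has_field_derivative_iff)
  then have "((\<lambda>q. (?f q - ?f 0) / q) \<longlongrightarrow> D) (at 0 within S)"
    by (rule tendsto_within_subset) auto
  then have "(\<lambda>q. ?f q - ?f 0) \<in> O[at 0 within S](\<lambda>q. q)"
    by (rule bigoI_tendsto) (simp add: eventually_at_filter)
  then show ?thesis by simp
qed

lemma leading_class_at_fixed_point:
  fixes z :: "complex ^ 'n"
  shows "class_at z (leading_class \<alpha> CARD('n) p) $ J =
    twisted_power \<alpha> CARD('n) p (z $ J) * (\<Prod>a\<in>UNIV - {J}. Gamma (1 + z $ a - z $ J))"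
  by (simp add: class_at_def leading_class_def c1_def taut_roots_def gamma_class_def
      tangent_roots_def other_weights_def image_mset.compositionality comp_def
      prod_unfold_prod_mset add_diff_eq)

theorem theorem4p3:
  fixes z :: "complex ^ 'n" and J :: 'n and \<theta> :: real and \<alpha> :: "complex \<Rightarrow> real"
  assumes n_ge_2: "CARD('n) \<ge> 2"
    and branch: "arg_branch (slit_plane \<theta>) \<alpha>"
    and z: "z \<in> nonresonant"
  shows "(\<forall>p\<in>slit_plane \<theta>.
            class_at z (leading_class \<alpha> CARD('n) p) $ J =
              twisted_power \<alpha> CARD('n) p (z $ J) *
              (\<Prod>a\<in>UNIV - {J}. Gamma (1 + z $ a - z $ J))) \<and>
         (\<exists>R :: complex \<Rightarrow> complex ^ 'n.
            (\<forall>p\<in>slit_plane \<theta>.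
               class_at z (\<lambda>x Y. Psi \<alpha> J p Y z) =
                 (class_at z (leading_class \<alpha> CARD('n) p) $ J) *s (Delta J + R p)) \<and>
            (\<forall>I. (\<lambda>p. R p $ I) \<in> O[at 0 within slit_plane \<theta>](\<lambda>p. p)))"
proof (intro conjI ballI leading_class_at_fixed_point)
  define G where "G = (\<Prod>a\<in>UNIV - {J}. Gamma (1 + z $ a - z $ J))"
  define c where "c = solution_coeff z J"
  \<comment> \<open>The non-constant part of the series, divided by the gamma class at the \<open>J\<close>-th fixed point.\<close>
  define R :: "complex \<Rightarrow> complex ^ 'n"
    where "R p = (\<chi> I. inverse G * ((\<Sum>r. c I r * p ^ r) - c I 0))" for p
  have "1 + z $ a - z $ J \<notin> \<int>" if "a \<noteq> J" for a
    using z that Ints_diff[OF _ Ints_1, of "1 + z $ a - z $ J"]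
    by (auto simp: nonresonant_def)
  then have "G \<noteq> 0"
    by (auto simp: G_def Gamma_eq_zero_iff elim: nonpos_Ints_cases)
  have "class_at z (\<lambda>x Y. Psi \<alpha> J p Y z) =
      (class_at z (leading_class \<alpha> CARD('n) p) $ J) *s (Delta J + R p)"
    if p: "p \<in> slit_plane \<theta>" for p
  proof -
    have "p \<noteq> 0"
      using p by (force simp: slit_plane_def)
    moreover have "(\<Sum>r. c I r * p ^ r) = G * (Delta J $ I + R p $ I)" for I
      using \<open>G \<noteq> 0\<close> solution_coeff_0[OF z, of J I]
      by (simp add: R_def c_def G_def[symmetric] field_simps)
    ultimately show ?thesis
      using Psi_eq_power_series[OF z branch p]
      by (simp add: vec_eq_iff leading_class_at_fixed_point algebra_simps
          class_at_def[of z "\<lambda>x Y. Psi \<alpha> J p Y z"] flip: c_def G_def)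
  qed
  moreover have "(\<lambda>p. R p $ I) \<in> O[at 0 within slit_plane \<theta>](\<lambda>p. p)" for I
    using power_series_remainder_bigo[OF solution_coeff_summable[OF z], of J I]
    by (simp add: R_def c_def cmult_in_bigo_iff)
  ultimately show "\<exists>R :: complex \<Rightarrow> complex ^ 'n.
            (\<forall>p\<in>slit_plane \<theta>.
               class_at z (\<lambda>x Y. Psi \<alpha> J p Y z) =
                 (class_at z (leading_class \<alpha> CARD('n) p) $ J) *s (Delta J + R p)) \<and>
            (\<forall>I. (\<lambda>p. R p $ I) \<in> O[at 0 within slit_plane \<theta>](\<lambda>p. p))"
    by blast
qed

end
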